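(* Let $E=\{1,\dots,n\}$, let $M=(E,\mathcal{I})$ be a matroid with rank function $\rho$, let $M^{\perp}$ be its dual matroid, and let $f\in\mathrm{Harm}_d$ be a harmonic function of degree $d$ on $E$. Then \[ T(M^{\perp},f;x,y)=(-1)^{d}\,T(M,f;y,x). \]
   Context: For $0\le d\le n$, $E_d$ denotes the set of $d$-element subsets of $E$. A function $f:E_d\to\mathbb{R}$ (identified with $\sum_{Z\in E_d} f(Z)Z\in\mathbb{R}E_d$) is extended to all subsets $X\subset E$ by $\widetilde f(X):=\sum_{Z\in E_d,\,Z\subset X} f(Z)$. The differentiation operator $\gamma$ is the linear map $\mathbb{R}E_d\to\mathbb{R}E_{d-1}$ with $\gamma(Z)=\sum_{Y\in E_{d-1},\,Y\subset Z} Y$, and $\mathrm{Harm}_d:=\ker(\gamma|_{\mathbb{R}E_d})$; equivalently $f\in\mathrm{Harm}_d$ iff $\sum_{Z\in E_d,\,Z\supset Y} f(Z)=0$ for every $Y\in E_{d-1}$. The weighted (harmonic) Tutte polynomial of a matroid $M$ on $E$ with rank function $\rho$ associated with $f$ is \[ T(M,f;x,y):=\sum_{J\subset E}\widetilde f(J)\,(x-1)^{\rho(E)-\rho(J)}(y-1)^{|J|-\rho(J)}. \] The dual matroid $M^{\perp}=(E,\mathcal{I}^{\perp})$ has as independent sets the subsets of complements $E\setminus A$ of bases $A$ of $M$; its rank function is $\rho^{\perp}(J)=|J|+\rho(E\setminus J)-\rho(E)$. *)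

theory Defs
  imports "HOL-Computational_Algebra.Polynomial"
begin

locale matroid =
  fixes E :: "'a set" and I :: "'a set set"
  assumes finite_ground: "finite E"
    and indep_subset_ground: "A \<in> I \<Longrightarrow> A \<subseteq> E"
    and indep_empty: "{} \<in> I"
    and indep_subset: "A \<in> I \<Longrightarrow> B \<subseteq> A \<Longrightarrow> B \<in> I"
    and indep_augment: "A \<in> I \<Longrightarrow> B \<in> I \<Longrightarrow> card A < card B
      \<Longrightarrow> \<exists>x\<in>B - A. insert x A \<in> I"

definition matroid_rank :: "'a set set \<Rightarrow> 'a set \<Rightarrow> nat" where
  "matroid_rank I J = Max (card ` {A \<in> I. A \<subseteq> J})"

definition matroid_bases :: "'a set set \<Rightarrow> 'a set set" where
  "matroid_bases I = {A \<in> I. \<forall>B\<in>I. A \<subseteq> B \<longrightarrow> A = B}"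

definition dual_indep :: "'a set \<Rightarrow> 'a set set \<Rightarrow> 'a set set" where
  "dual_indep E I = {B. \<exists>A\<in>matroid_bases I. B \<subseteq> E - A}"

text \<open>The degree is an integer so that the level below degree 0 is empty. With natural-number
  subtraction it would be level 0 again, and harmonic functions of degree 0 would wrongly vanish.\<close>
definition subsets_of_card :: "'a set \<Rightarrow> int \<Rightarrow> 'a set set" where
  "subsets_of_card E d = {Z. Z \<subseteq> E \<and> int (card Z) = d}"

text \<open>The real vector space spanned by the d-subsets of E: the formal sum of all f(Z) Z is
  represented by f, extended by 0 to all sets that are not d-subsets of E.\<close>
definition formal_sums :: "'a set \<Rightarrow> int \<Rightarrow> ('a set \<Rightarrow> real) set" where
  "formal_sums E d = {f. \<forall>Z. Z \<notin> subsets_of_card E d \<longrightarrow> f Z = 0}"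

definition basis_elem :: "'a set \<Rightarrow> 'a set \<Rightarrow> real" where
  "basis_elem Y = (\<lambda>W. if W = Y then 1 else 0)"

text \<open>The linear extension of the map sending a d-subset Z to the sum of its (d-1)-subsets.\<close>
definition differentiation :: "'a set \<Rightarrow> int \<Rightarrow> ('a set \<Rightarrow> real) \<Rightarrow> 'a set \<Rightarrow> real" where
  "differentiation E d f =
     (\<lambda>W. \<Sum>Z\<in>subsets_of_card E d.
        f Z * (\<Sum>Y\<in>{Y \<in> subsets_of_card E (d - 1). Y \<subseteq> Z}. basis_elem Y W))"

definition Harm :: "'a set \<Rightarrow> int \<Rightarrow> ('a set \<Rightarrow> real) set" where
  "Harm E d = {f \<in> formal_sums E d. differentiation E d f = (\<lambda>W. 0)}"

definition extend_to_subsets :: "'a set \<Rightarrow> int \<Rightarrow> ('a set \<Rightarrow> real) \<Rightarrow> 'a set \<Rightarrow> real" where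
  "extend_to_subsets E d f X = (\<Sum>Z\<in>{Z \<in> subsets_of_card E d. Z \<subseteq> X}. f Z)"

text \<open>Bivariate real polynomials are rendered as polynomials in y over the polynomials in x.\<close>
definition var_x :: "real poly poly" where
  "var_x = [:[:0, 1:]:]"

definition var_y :: "real poly poly" where
  "var_y = [:0, 1:]"

text \<open>For a matroid (E, I) and J a subset of E, the rank of J is at most the rank of E and at most
  the cardinality of J, so the subtractions in the exponents are not truncated.\<close>
definition weighted_tutte ::
    "'a set \<Rightarrow> 'a set set \<Rightarrow> int \<Rightarrow> ('a set \<Rightarrow> real)
      \<Rightarrow> real poly poly \<Rightarrow> real poly poly \<Rightarrow> real poly poly" where
  "weighted_tutte E I d f x y =
     (\<Sum>J\<in>Pow E. [:[:extend_to_subsets E d f J:]:]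
        * (x - 1) ^ (matroid_rank I E - matroid_rank I J)
        * (y - 1) ^ (card J - matroid_rank I J))"

end

theory Submission imports Defs begin

text \<open>For a harmonic \<open>f\<close> of degree \<open>d\<close>, the sum of \<open>f\<close> over the supersets of a set \<open>Y\<close> vanishes
  whenever \<open>card Y < d\<close>: for \<open>card Y = d - 1\<close> this is harmonicity, and summing over the one-point
  extensions of \<open>Y\<close> carries it downwards. By inclusion-exclusion over the subsets of \<open>J\<close>, only those
  of size \<open>d\<close> survive, so the extension of \<open>f\<close> takes at \<open>E - J\<close> the value at \<open>J\<close> times
  \<open>(- 1) ^ d\<close>. By the dual rank formula, the substitution of \<open>E - J\<close> for \<open>J\<close> exchanges the two
  exponents in the Tutte polynomial.\<close>

section \<open>Finiteness and alternating sums over a power set\<close>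

lemma finite_subsets_of_card:
  assumes "finite E"
  shows "finite (subsets_of_card E d)"
  by (rule finite_subset[of _ "Pow E"]) (use assms in \<open>auto simp: subsets_of_card_def\<close>)

text \<open>Expanding the product of the factors \<open>- 1 + 1\<close> over \<open>A\<close>
  chooses \<open>- 1\<close> on a subset \<open>Y\<close> and \<open>1\<close> elsewhere; the
  product is 0 unless it is empty.\<close>

lemma sum_alternating_Pow:
  assumes "finite A"
  shows "(\<Sum>Y\<in>Pow A. (- 1) ^ card Y) = (if A = {} then 1 else (0::'a::comm_ring_1))"
proof -
  have "(\<Sum>Y\<in>Pow A. (- 1) ^ card Y) = (\<Prod>x\<in>A. - 1 + (1::'a))"
    by (subst prod_add[OF assms]) simp
  then show ?thesis
    using assms by (simp add: zero_power card_gt_0_iff)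
qed

section \<open>Sums over supersets and harmonic functions\<close>

text \<open>For \<open>Y \<subseteq> E\<close> with \<open>card Y \<le> d\<close>, this is the
  coefficient at \<open>Y\<close> of the \<open>(d - card Y)\<close>-fold differentiation of
  \<open>f\<close>, divided by the factorial of \<open>d - card Y\<close>.\<close>

definition superset_sum :: "'a set \<Rightarrow> int \<Rightarrow> ('a set \<Rightarrow> real) \<Rightarrow> 'a set \<Rightarrow> real" where
  "superset_sum E d f Y = (\<Sum>Z\<in>{Z \<in> subsets_of_card E d. Y \<subseteq> Z}. f Z)"

lemma differentiation_eq_superset_sum:
  assumes "finite E" "Y \<in> subsets_of_card E (d - 1)"
  shows "differentiation E d f Y = superset_sum E d f Y"
proof -
  have fin: "finite (subsets_of_card E k)" for k
    using finite_subsets_of_card[OF assms(1)] .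
  have "(\<Sum>W\<in>{W \<in> subsets_of_card E (d - 1). W \<subseteq> Z}. basis_elem W Y) = (if Y \<subseteq> Z then 1 else 0)" for Z
    using fin assms(2) by (simp add: basis_elem_def)
  then have "differentiation E d f Y = (\<Sum>Z\<in>subsets_of_card E d. if Y \<subseteq> Z then f Z else 0)"
    unfolding differentiation_def by (intro sum.cong) auto
  also have "\<dots> = superset_sum E d f Y"
    unfolding superset_sum_def using sum.inter_filter[OF fin] by metis
  finally show ?thesis .
qed

text \<open>Double counting: a \<open>d\<close>-set \<open>Z\<close> above \<open>Y\<close> occurs
  on the left once for each element of \<open>Z - Y\<close>, hence \<open>d - card Y\<close> times.
  If \<open>card Y > d\<close>, there is no such \<open>Z\<close> and both sides are 0.\<close>

lemma sum_superset_sum_insert: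
  assumes "finite E" "Y \<subseteq> E"
  shows "(\<Sum>y\<in>E - Y. superset_sum E d f (insert y Y))
    = of_int (d - int (card Y)) * superset_sum E d f Y"
proof -
  let ?S = "subsets_of_card E d"
  have fin: "finite ?S"
    using finite_subsets_of_card[OF assms(1)] .
  have "(\<Sum>y\<in>E - Y. superset_sum E d f (insert y Y))
      = (\<Sum>y\<in>E - Y. \<Sum>Z\<in>{Z \<in> ?S. Y \<subseteq> Z}. if y \<in> Z then f Z else 0)"
    unfolding superset_sum_def using fin
    by (intro sum.cong refl sum.mono_neutral_cong_left) auto
  also have "\<dots> = (\<Sum>Z\<in>{Z \<in> ?S. Y \<subseteq> Z}. \<Sum>y\<in>E - Y. if y \<in> Z then f Z else 0)"
    by (rule sum.swap)
  also have "\<dots> = (\<Sum>Z\<in>{Z \<in> ?S. Y \<subseteq> Z}. of_int (d - int (card Y)) * f Z)"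
  proof (intro sum.cong refl)
    fix Z assume "Z \<in> {Z \<in> ?S. Y \<subseteq> Z}"
    then have Z: "Z \<subseteq> E" "int (card Z) = d" "Y \<subseteq> Z"
      by (auto simp: subsets_of_card_def)
    have fZ: "finite Z" "finite Y"
      using Z assms finite_subset by blast+
    have "(\<Sum>y\<in>E - Y. if y \<in> Z then f Z else 0) = (\<Sum>y\<in>Z - Y. f Z)"
      using assms Z by (intro sum.mono_neutral_cong_right) auto
    also have "int (card (Z - Y)) = d - int (card Y)"
      using Z fZ by (simp add: card_Diff_subset card_mono of_nat_diff)
    then have "(\<Sum>y\<in>Z - Y. f Z) = of_int (d - int (card Y)) * f Z"
      by (metis of_int_of_nat_eq sum_constant)
    finally show "(\<Sum>y\<in>E - Y. if y \<in> Z then f Z else 0) = of_int (d - int (card Y)) * f Z" .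
  qed
  finally show ?thesis
    by (simp add: superset_sum_def sum_distrib_left)
qed

lemma Harm_superset_sum_eq_0:
  assumes "finite E" "f \<in> Harm E d" "Y \<subseteq> E" "int (card Y) < d"
  shows "superset_sum E d f Y = 0"
  using assms(3,4)
proof (induction "nat (d - int (card Y))" arbitrary: Y rule: less_induct)
  case less
  show ?case
  proof (cases "int (card Y) = d - 1")
    case True
    then have "Y \<in> subsets_of_card E (d - 1)"
      using less.prems by (simp add: subsets_of_card_def)
    moreover have "differentiation E d f Y = 0"
      using assms(2) by (simp add: Harm_def)
    ultimately show ?thesis
      using differentiation_eq_superset_sum[OF assms(1)] by metis
  next
    case False
    have fY: "finite Y"
      using less.prems(1) assms(1) finite_subset by blast
    \<comment> \<open>The case \<open>card Y = d - 1\<close> being excluded, the enlarged set still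
      has fewer than \<open>d\<close> elements and is closer to the base level.\<close>
    have "superset_sum E d f (insert y Y) = 0" if "y \<in> E - Y" for y
      using that less.prems False fY by (intro less.hyps) auto
    then have "(\<Sum>y\<in>E - Y. superset_sum E d f (insert y Y)) = 0"
      by simp
    then have "of_int (d - int (card Y)) * superset_sum E d f Y = 0"
      by (simp only: sum_superset_sum_insert[OF assms(1) less.prems(1)])
    \<comment> \<open>The factor is positive because \<open>card Y < d\<close>, so it can be
      cancelled.\<close>
    moreover have "real_of_int (d - int (card Y)) \<noteq> 0"
      using less.prems(2) by (simp only: of_int_eq_0_iff)
    ultimately show ?thesis
      by (auto simp only: mult_eq_0_iff)
  qed
qed

lemma superset_sum_top:
  assumes "finite E" "Y \<subseteq> E"
  shows "superset_sum E (int (card Y)) f Y = f Y"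
proof -
  have "{Z \<in> subsets_of_card E (int (card Y)). Y \<subseteq> Z} = {Y}"
    using assms by (auto simp: subsets_of_card_def) (metis card_subset_eq finite_subset subsetD)
  then show ?thesis
    by (simp add: superset_sum_def)
qed

lemma superset_sum_eq_0:
  assumes "finite E" "d < int (card Y)"
  shows "superset_sum E d f Y = 0"
proof -
  have "{Z \<in> subsets_of_card E d. Y \<subseteq> Z} = {}"
  proof (rule ccontr)
    assume "{Z \<in> subsets_of_card E d. Y \<subseteq> Z} \<noteq> {}"
    then obtain Z where "Z \<subseteq> E" "int (card Z) = d" "Y \<subseteq> Z"
      by (auto simp: subsets_of_card_def)
    moreover from this have "card Y \<le> card Z"
      using assms(1) by (meson card_mono finite_subset)
    ultimately show False
      using assms(2) by simp
  qed
  then show ?thesis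
    by (simp only: superset_sum_def sum.empty)
qed

lemma extend_to_subsets_Diff:
  assumes "finite E" "f \<in> Harm E (int d)" "J \<subseteq> E"
  shows "extend_to_subsets E (int d) f (E - J) = (- 1) ^ d * extend_to_subsets E (int d) f J"
proof -
  let ?S = "subsets_of_card E (int d)"
  have fin: "finite ?S"
    using finite_subsets_of_card[OF assms(1)] .
  have fJ: "finite J"
    using assms finite_subset by blast
  have "extend_to_subsets E (int d) f (E - J) = (\<Sum>Z\<in>?S. f Z * (if Z \<inter> J = {} then 1 else 0))"
    unfolding extend_to_subsets_def using fin
    by (intro sum.mono_neutral_cong_left) (auto simp: subsets_of_card_def)
  \<comment> \<open>The indicator of disjointness is written as an alternating sum, so that
    exchanging the sums produces superset sums of subsets of \<open>J\<close>.\<close>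
  also have "\<dots> = (\<Sum>Z\<in>?S. f Z * (\<Sum>Y\<in>Pow (Z \<inter> J). (- 1) ^ card Y))"
    using fJ by (intro sum.cong refl) (simp add: sum_alternating_Pow del: Pow_Int_eq)
  also have "\<dots> = (\<Sum>Z\<in>?S. \<Sum>Y\<in>Pow J. if Y \<subseteq> Z then (- 1) ^ card Y * f Z else 0)"
    unfolding sum_distrib_left using fJ
    by (intro sum.cong refl sum.mono_neutral_cong_left) auto
  also have "\<dots> = (\<Sum>Y\<in>Pow J. \<Sum>Z\<in>?S. if Y \<subseteq> Z then (- 1) ^ card Y * f Z else 0)"
    by (rule sum.swap)
  also have "\<dots> = (\<Sum>Y\<in>Pow J. (- 1) ^ card Y * superset_sum E (int d) f Y)"
    unfolding superset_sum_def sum_distrib_left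
    by (intro sum.cong refl sum.inter_filter[symmetric] fin)
  \<comment> \<open>Harmonicity removes the \<open>Y\<close> with fewer than \<open>d\<close>
    elements; those with more have no \<open>d\<close>-superset. A \<open>d\<close>-set
    \<open>Y\<close> is its own only \<open>d\<close>-superset.\<close>
  also have "\<dots> = (\<Sum>Y\<in>{Z \<in> ?S. Z \<subseteq> J}. (- 1) ^ d * f Y)"
  proof (intro sum.mono_neutral_cong_right ballI)
    show "finite (Pow J)"
      using fJ by simp
    show "{Z \<in> ?S. Z \<subseteq> J} \<subseteq> Pow J"
      by auto
    fix Y
    show "(- 1) ^ card Y * superset_sum E (int d) f Y = 0" if "Y \<in> Pow J - {Z \<in> ?S. Z \<subseteq> J}"
    proof -
      have "Y \<subseteq> E" "card Y \<noteq> d"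
        using that assms(3) by (auto simp: subsets_of_card_def)
      then have "superset_sum E (int d) f Y = 0"
        using Harm_superset_sum_eq_0[OF assms(1,2)] superset_sum_eq_0[OF assms(1)]
        by (metis linorder_neqE_nat of_nat_less_iff)
      then show ?thesis
        by simp
    qed
    show "(- 1) ^ card Y * superset_sum E (int d) f Y = (- 1) ^ d * f Y" if "Y \<in> {Z \<in> ?S. Z \<subseteq> J}"
      using that superset_sum_top[OF assms(1), of Y f] by (auto simp: subsets_of_card_def)
  qed
  finally show ?thesis
    by (simp add: extend_to_subsets_def sum_distrib_left)
qed

section \<open>Rank, bases and the dual rank formula\<close>

context matroid
begin

lemma finite_indep: "A \<in> I \<Longrightarrow> finite A"
  using finite_ground indep_subset_ground finite_subset by blast

lemma finite_indeps: "finite I"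
  by (rule finite_subset[of _ "Pow E"]) (use indep_subset_ground finite_ground in auto)

lemma card_le_rank: "A \<in> I \<Longrightarrow> A \<subseteq> J \<Longrightarrow> card A \<le> matroid_rank I J"
  unfolding matroid_rank_def using finite_indeps by (intro Max_ge) auto

lemma rank_attained:
  obtains A where "A \<in> I" "A \<subseteq> J" "card A = matroid_rank I J"
proof -
  have "matroid_rank I J \<in> card ` {A \<in> I. A \<subseteq> J}"
    unfolding matroid_rank_def using finite_indeps indep_empty by (intro Max_in) auto
  then show ?thesis
    using that by auto
qed

text \<open>A smaller basis could be augmented from an independent set of maximal size, against its
  maximality.\<close>

lemma basis_card:
  assumes "A \<in> matroid_bases I"
  shows "card A = matroid_rank I E"
proof (rule ccontr)
  assume ne: "card A \<noteq> matroid_rank I E"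
  have A: "A \<in> I" "\<And>B. B \<in> I \<Longrightarrow> A \<subseteq> B \<Longrightarrow> A = B"
    using assms by (auto simp: matroid_bases_def)
  obtain B where B: "B \<in> I" "card B = matroid_rank I E"
    using rank_attained by metis
  have "card A < card B"
    using ne B(2) card_le_rank[OF A(1) indep_subset_ground[OF A(1)]] by simp
  then obtain x where "x \<in> B - A" "insert x A \<in> I"
    using indep_augment A(1) B(1) by blast
  then show False
    using A(2)[of "insert x A"] by blast
qed

lemma indep_extend_basis:
  assumes "A \<in> I"
  obtains B where "B \<in> matroid_bases I" "A \<subseteq> B"
  using finite_has_maximal2[OF finite_indeps assms] that
  by (auto simp: matroid_bases_def)

text \<open>A basis \<open>A\<close> leaves room in \<open>J\<close> for a dual independent set of
  size \<open>card J - card (A \<inter> J)\<close>. This is largest when \<open>A\<close> has as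
  many elements as possible outside \<open>J\<close>, namely the rank of \<open>E - J\<close>. The
  additive form avoids truncated subtraction.\<close>

lemma dual_rank:
  assumes "J \<subseteq> E"
  shows "matroid_rank (dual_indep E I) J + matroid_rank I E = card J + matroid_rank I (E - J)"
proof -
  let ?D = "{B \<in> dual_indep E I. B \<subseteq> J}"
  have fJ: "finite J"
    using assms finite_ground finite_subset by blast
  have split: "card A = card (A \<inter> J) + card (A - J)" if "finite A" for A :: "'a set"
    using that by (rule card_Int_Diff)
  have "Max (card ` ?D) = card J + matroid_rank I (E - J) - matroid_rank I E"
  proof (rule Max_eqI)
    show "finite (card ` ?D)"
      using fJ by (intro finite_imageI finite_subset[of ?D "Pow J"]) auto
  next
    fix k assume "k \<in> card ` ?D"
    then obtain A B where B: "k = card B" "B \<subseteq> J" "A \<in> matroid_bases I" "B \<subseteq> E - A"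
      by (auto simp: dual_indep_def)
    have A: "A \<in> I"
      using B(3) by (simp add: matroid_bases_def)
    have "A - J \<in> I" "A - J \<subseteq> E - J"
      using indep_subset[OF A] indep_subset_ground[OF A] by auto
    then have "card (A - J) \<le> matroid_rank I (E - J)"
      by (rule card_le_rank)
    \<comment> \<open>\<open>B\<close> avoids \<open>A\<close>, so \<open>B\<close> and
      \<open>A \<inter> J\<close> are disjoint subsets of \<open>J\<close>.\<close>
    moreover have "card B + card (A \<inter> J) \<le> card J"
    proof -
      have "card B + card (A \<inter> J) = card (B \<union> A \<inter> J)"
        using B fJ finite_subset[of B J] by (subst card_Un_disjoint) auto
      also have "\<dots> \<le> card J"
        using B fJ by (intro card_mono) auto
      finally show ?thesis .
    qed
    ultimately show "k \<le> card J + matroid_rank I (E - J) - matroid_rank I E"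
      using basis_card[OF B(3)] split[OF finite_indep[OF A]] B(1) by linarith
  next
    \<comment> \<open>The maximum is attained at \<open>J - A\<close>, where the basis
      \<open>A\<close> extends a largest independent subset \<open>C\<close> of
      \<open>E - J\<close>.\<close>
    obtain C where C: "C \<in> I" "C \<subseteq> E - J" "card C = matroid_rank I (E - J)"
      using rank_attained by metis
    obtain A where A: "A \<in> matroid_bases I" "C \<subseteq> A"
      using indep_extend_basis[OF C(1)] by metis
    have AI: "A \<in> I"
      using A(1) by (simp add: matroid_bases_def)
    have AJ: "A - J \<in> I" "A - J \<subseteq> E - J"
      using indep_subset[OF AI] indep_subset_ground[OF AI] by auto
    have "card C \<le> card (A - J)"
      using A C finite_indep[OF AI] by (intro card_mono) auto
    then have "card (A - J) = matroid_rank I (E - J)"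
      using card_le_rank[OF AJ] C(3) by simp
    moreover have "card (J - A) + card (A \<inter> J) = card J"
      using fJ by (metis Int_commute add.commute card_Int_Diff)
    ultimately have "card (J - A) = card J + matroid_rank I (E - J) - matroid_rank I E"
      using basis_card[OF A(1)] split[OF finite_indep[OF AI]] by linarith
    moreover have "J - A \<in> ?D"
      using A(1) assms by (auto simp: dual_indep_def)
    ultimately show "card J + matroid_rank I (E - J) - matroid_rank I E \<in> card ` ?D"
      by (metis imageI)
  qed
  \<comment> \<open>This makes the subtraction in the computed maximum exact.\<close>
  moreover have "matroid_rank I E \<le> card J + matroid_rank I (E - J)"
  proof -
    obtain A where A: "A \<in> I" "card A = matroid_rank I E"
      using rank_attained by metis
    have "A - J \<in> I" "A - J \<subseteq> E - J"
      using indep_subset[OF A(1)] indep_subset_ground[OF A(1)] by auto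
    then have "card (A - J) \<le> matroid_rank I (E - J)"
      by (rule card_le_rank)
    moreover have "card (A \<inter> J) \<le> card J"
      using fJ by (intro card_mono) auto
    ultimately show ?thesis
      using split[OF finite_indep[OF A(1)]] A(2) by linarith
  qed
  ultimately show ?thesis
    by (simp add: matroid_rank_def)
qed

lemma rank_le_card:
  assumes "finite J"
  shows "matroid_rank I J \<le> card J"
  using rank_attained[of J] card_mono[OF assms] by metis

lemma rank_mono:
  assumes "J \<subseteq> K"
  shows "matroid_rank I J \<le> matroid_rank I K"
  using rank_attained[of J] card_le_rank assms by (metis subset_trans)

section \<open>Duality of the weighted Tutte polynomial\<close>

theorem weighted_tutte_dual:
  assumes "f \<in> Harm E (int d)"
  shows "weighted_tutte E (dual_indep E I) (int d) f x y
       = (- 1) ^ d * weighted_tutte E I (int d) f y x"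
proof -
  let ?r = "matroid_rank I" and ?r' = "matroid_rank (dual_indep E I)"
  let ?e = "extend_to_subsets E (int d) f"
  have "weighted_tutte E (dual_indep E I) (int d) f x y
      = (\<Sum>J\<in>Pow E. [:[:?e (E - J):]:] * (x - 1) ^ (?r' E - ?r' (E - J))
          * (y - 1) ^ (card (E - J) - ?r' (E - J)))"
    unfolding weighted_tutte_def
    by (rule sum.reindex_bij_witness[of _ "\<lambda>J. E - J" "\<lambda>J. E - J"])
      (simp_all add: double_diff)
  also have "\<dots> = (\<Sum>J\<in>Pow E. (- 1) ^ d * ([:[:?e J:]:] * (y - 1) ^ (?r E - ?r J)
          * (x - 1) ^ (card J - ?r J)))"
  proof (rule sum.cong[OF refl])
    fix J assume "J \<in> Pow E"
    then have J: "J \<subseteq> E" "finite J"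
      using finite_ground finite_subset by auto
    have rank_J: "?r' (E - J) + ?r E = card (E - J) + ?r J"
      using dual_rank[of "E - J"] J by (simp add: double_diff)
    \<comment> \<open>The dual rank formula at \<open>E\<close> leaves only the rank of the empty
      set, which is 0.\<close>
    have rank_E: "?r' E + ?r E = card E"
      using dual_rank[of E] rank_le_card[of "{}"] by simp
    have card_E: "card E = card J + card (E - J)"
      using J finite_ground by (simp add: card_Diff_subset card_mono)
    \<comment> \<open>Complementation turns dual corank into nullity and dual nullity into corank;
      monotonicity of the rank and its bound by the cardinality exclude truncation.\<close>
    have "?r' E - ?r' (E - J) = card J - ?r J" "card (E - J) - ?r' (E - J) = ?r E - ?r J"
      using rank_J rank_E card_E rank_mono[OF J(1)] rank_le_card[OF J(2)] by linarith+
    \<comment> \<open>The parity of \<open>d\<close> reduces the sign to 1 or -1, which passes from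
      the reals through both constant-polynomial embeddings.\<close>
    moreover have "[:[:?e (E - J):]:] = (- 1) ^ d * [:[:?e J:]:]"
      using extend_to_subsets_Diff[OF finite_ground assms J(1)]
      by (cases "even d") simp_all
    ultimately show "[:[:?e (E - J):]:] * (x - 1) ^ (?r' E - ?r' (E - J))
          * (y - 1) ^ (card (E - J) - ?r' (E - J))
        = (- 1) ^ d * ([:[:?e J:]:] * (y - 1) ^ (?r E - ?r J) * (x - 1) ^ (card J - ?r J))"
      by (simp only: ac_simps)
  qed
  finally show ?thesis
    by (simp add: weighted_tutte_def sum_distrib_left)
qed

end

theorem theorem2p3:
  fixes n d :: nat and I :: "nat set set" and f :: "nat set \<Rightarrow> real"
  assumes "d \<le> n"
    and "matroid {1..n} I"
    and "f \<in> Harm {1..n} (int d)"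
  shows "weighted_tutte {1..n} (dual_indep {1..n} I) (int d) f var_x var_y
       = (- 1) ^ d * weighted_tutte {1..n} I (int d) f var_y var_x"
  using matroid.weighted_tutte_dual[OF assms(2,3)] .

end
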